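(* Let $n\ge 1$, let $k\ge 1$ be an integer and let $\lambda\in\mathcal{P}[n]$. Then $$p^{\alpha}_k(X^n)\,G_{\lambda}^{(\alpha,\beta)}(X^n)=\sum_{\nu}(-\alpha-\beta)^{|\nu/\lambda|-k}\,(-1)^{k-c(\nu/\lambda)}\binom{r(\nu/\lambda)-1}{k-c(\nu/\lambda)}\,G_{\nu}^{(\alpha,\beta)}(X^n),$$ where the sum runs over all partitions $\nu\in\mathcal{P}[n]$ such that $\lambda\subseteq\nu$, $c(\nu/\lambda)\le k$, $\nu/\lambda$ is connected, and the maximal ribbon along the northwest border of $\nu/\lambda$ has size (number of boxes) at least $k$.
   Context: Let $n$ be a positive integer, $X^n=(x_1,\dots,x_n)$ commuting indeterminates, and $\alpha,\beta$ further commuting indeterminates (parameters); expressions $\frac{1}{1-\alpha x_i}$ are read as rational functions (or as power series in $x_i$). $\mathcal{P}[n]$ is the set of partitions with at most $n$ nonzero parts, i.e. integer sequences $\lambda=(\lambda_1\ge\cdots\ge\lambda_n\ge 0)$. The Young diagram $Y(\lambda)$ is the top- and left-justified array of boxes with $\lambda_i$ boxes in row $i$ (rows numbered from top to bottom). Write $\lambda\subseteq\nu$ if $\lambda_i\le\nu_i$ for all $i$; then the skew shape $\nu/\lambda$ is the set difference $Y(\nu)-Y(\lambda)$, $|\nu/\lambda|$ is its number of boxes, and $r(\nu/\lambda)$, $c(\nu/\lambda)$ are its numbers of (non-empty) rows and (non-empty) columns. Two boxes are adjacent if they share an edge. A skew shape is connected if every pair of its boxes is joined by a sequence of successively adjacent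 boxes contained in the shape. A ribbon is a connected skew shape containing no $2\times 2$ square of boxes. The maximal ribbon along the northwest border of a connected skew shape $\nu/\lambda$ is the largest possible ribbon of the form $\mu/\lambda$ (with $\mu$ a partition, $\lambda\subseteq\mu\subseteq\nu$) lying within $\nu/\lambda$. The canonical stable Grothendieck function is $$G_{\lambda}^{(\alpha,\beta)}(X^n):=\frac{\det\left[\dfrac{x_i^{\lambda_j+n-j}(1+\beta x_i)^{j-1}}{(1-\alpha x_i)^{\lambda_j}}\right]_{1\le i,j\le n}}{\prod_{1\le i<j\le n}(x_i-x_j)}.$$ For $k\ge 1$, $$p^{\alpha}_k(X^n):=p_k\left(\frac{x_1}{1-\alpha x_1},\dots,\frac{x_n}{1-\alpha x_n}\right)=\sum_{j=1}^n\left(\frac{x_j}{1-\alpha x_j}\right)^k,$$ where $p_k(X^n)=\sum_{j=1}^n x_j^k$ is the power sum. *)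

theory Defs
  imports
    "Jordan_Normal_Form.Determinant"
    "HOL-Library.Poly_Mapping"
    "HOL-Computational_Algebra.Fraction_Field"
begin

text \<open>A partition \<open>lam 1 \<ge> \<dots> \<ge> lam n \<ge> 0\<close> is encoded as a function on all of
  \<open>nat\<close>, forced to vanish off \<open>{1..n}\<close> so that each partition has exactly one representative.
  Containment of partitions is then the pointwise order \<open>lam \<le> nu\<close> of functions.\<close>

definition partitions :: "nat \<Rightarrow> (nat \<Rightarrow> nat) set" where
  "partitions n = {lam. (\<forall>i j. 1 \<le> i \<and> i \<le> j \<and> j \<le> n \<longrightarrow> lam j \<le> lam i) \<and>
                        (\<forall>i. i \<notin> {1..n} \<longrightarrow> lam i = 0)}"

text \<open>Boxes are pairs (row, column), both counted from 1.\<close>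

definition diagram :: "(nat \<Rightarrow> nat) \<Rightarrow> (nat \<times> nat) set" where
  "diagram lam = {(i, j). 1 \<le> i \<and> 1 \<le> j \<and> j \<le> lam i}"

definition skew :: "(nat \<Rightarrow> nat) \<Rightarrow> (nat \<Rightarrow> nat) \<Rightarrow> (nat \<times> nat) set" where
  "skew nu lam = diagram nu - diagram lam"

definition num_rows :: "(nat \<times> nat) set \<Rightarrow> nat" where
  "num_rows S = card (fst ` S)"

definition num_cols :: "(nat \<times> nat) set \<Rightarrow> nat" where
  "num_cols S = card (snd ` S)"

definition adjacent :: "nat \<times> nat \<Rightarrow> nat \<times> nat \<Rightarrow> bool" where
  "adjacent p q \<longleftrightarrow>
     fst p = fst q \<and> (snd q = snd p + 1 \<or> snd p = snd q + 1) \<or>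
     snd p = snd q \<and> (fst q = fst p + 1 \<or> fst p = fst q + 1)"

definition connected_shape :: "(nat \<times> nat) set \<Rightarrow> bool" where
  "connected_shape S \<longleftrightarrow>
     (\<forall>p\<in>S. \<forall>q\<in>S. (\<lambda>a b. a \<in> S \<and> b \<in> S \<and> adjacent a b)\<^sup>*\<^sup>* p q)"

definition ribbon :: "(nat \<times> nat) set \<Rightarrow> bool" where
  "ribbon S \<longleftrightarrow> connected_shape S \<and>
     \<not> (\<exists>i j. {(i, j), (i + 1, j), (i, j + 1), (i + 1, j + 1)} \<subseteq> S)"

text \<open>Number of boxes of the largest ribbon of the form \<open>mu/lam\<close> inside \<open>nu/lam\<close>.  The choice
  \<open>mu = lam\<close> (empty ribbon) keeps the set nonempty; it is never maximal when
  \<open>nu/lam\<close> is nonempty.\<close>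

definition nw_ribbon_size :: "nat \<Rightarrow> (nat \<Rightarrow> nat) \<Rightarrow> (nat \<Rightarrow> nat) \<Rightarrow> nat" where
  "nw_ribbon_size n nu lam =
     Max {card (skew mu lam) | mu. mu \<in> partitions n \<and> lam \<le> mu \<and> mu \<le> nu \<and> ribbon (skew mu lam)}"

text \<open>JNF matrices are indexed from 0, hence the successors.\<close>

definition grothendieck ::
    "nat \<Rightarrow> 'a::field \<Rightarrow> 'a \<Rightarrow> (nat \<Rightarrow> 'a) \<Rightarrow> (nat \<Rightarrow> nat) \<Rightarrow> 'a" where
  "grothendieck n \<alpha> \<beta> x lam =
     (let entry = (\<lambda>i j. x i ^ (lam j + n - j) * (1 + \<beta> * x i) ^ (j - 1) / (1 - \<alpha> * x i) ^ lam j)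
      in det (mat n n (\<lambda>(i, j). entry (Suc i) (Suc j)))
         / (\<Prod>(i, j)\<in>{(i, j). 1 \<le> i \<and> i < j \<and> j \<le> n}. x i - x j))"

definition power_sum :: "nat \<Rightarrow> nat \<Rightarrow> (nat \<Rightarrow> 'a::field) \<Rightarrow> 'a" where
  "power_sum n k x = (\<Sum>j = 1..n. x j ^ k)"

definition power_sum_alpha :: "nat \<Rightarrow> 'a::field \<Rightarrow> nat \<Rightarrow> (nat \<Rightarrow> 'a) \<Rightarrow> 'a" where
  "power_sum_alpha n \<alpha> k x = power_sum n k (\<lambda>i. x i / (1 - \<alpha> * x i))"

text \<open>Rational functions over a coefficient domain in the commuting indeterminates
  \<open>indet 0, indet 1, \<dots>\<close>.  The first two serve as the parameters, the remaining
  ones as \<open>x 1, x 2, \<dots>\<close>.\<close>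

type_synonym 'c ratfun = "((nat \<Rightarrow>\<^sub>0 nat) \<Rightarrow>\<^sub>0 'c) fract"

definition indet :: "nat \<Rightarrow> 'c::idom ratfun" where
  "indet v = Fract (Poly_Mapping.single (Poly_Mapping.single v 1) 1) 1"

definition alpha_var :: "'c::idom ratfun" where
  "alpha_var = indet 0"

definition beta_var :: "'c::idom ratfun" where
  "beta_var = indet 1"

definition x_var :: "nat \<Rightarrow> 'c::idom ratfun" where
  "x_var i = indet (i + 1)"

text \<open>Sums over the partitions below are finite sums, so \<open>sum\<close> does not collapse to \<open>0\<close>.\<close>

lemma finite_bounded_col_shapes:
  "finite {nu \<in> partitions n. lam \<le> nu \<and> num_cols (skew nu lam) \<le> k}"
proof (rule finite_subset)
  show "{nu \<in> partitions n. lam \<le> nu \<and> num_cols (skew nu lam) \<le> k}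
      \<subseteq> {nu. \<forall>i. (i \<in> {1..n} \<longrightarrow> nu i \<in> {..Max (lam ` {1..n}) + k}) \<and> (i \<notin> {1..n} \<longrightarrow> nu i = 0)}"
  proof (clarify, intro conjI impI)
    fix nu i
    assume nu: "nu \<in> partitions n" and le: "lam \<le> nu" and k: "num_cols (skew nu lam) \<le> k"
    show "nu i = 0" if "i \<notin> {1..n}"
      using nu that by (simp add: partitions_def)
    show "nu i \<in> {..Max (lam ` {1..n}) + k}" if i: "i \<in> {1..n}"
    proof -
      have "diagram nu \<subseteq> (SIGMA i:{1..n}. {..nu i})"
        using nu by (force simp: diagram_def partitions_def)
      then have "finite (skew nu lam)"
        unfolding skew_def by (meson finite_Diff finite_SigmaI finite_atLeastAtMost
            finite_atMost finite_subset)
      moreover have "{lam i <.. nu i} \<subseteq> snd ` skew nu lam"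
      proof
        fix j assume "j \<in> {lam i <.. nu i}"
        then have "(i, j) \<in> skew nu lam"
          using i by (auto simp: skew_def diagram_def)
        then show "j \<in> snd ` skew nu lam" by force
      qed
      ultimately have "nu i - lam i \<le> k"
        using k card_mono[of "snd ` skew nu lam" "{lam i <.. nu i}"]
        by (simp add: num_cols_def)
      moreover have "lam i \<le> Max (lam ` {1..n})"
        using i by simp
      ultimately show ?thesis by simp
    qed
  qed
  show "finite {nu. \<forall>i. (i \<in> {1..n} \<longrightarrow> nu i \<in> {..Max (lam ` {1..n}) + k}) \<and>
      (i \<notin> {1..n} \<longrightarrow> nu i = (0::nat))}"
    by (rule finite_set_of_finite_funs) auto
qed

end

(* Write e t c for the column vector with entries x_i^(c+n-t) (1 + b x_i)^(t-1) / (1 - a x_i)^c, so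
   that the numerator of G_nu is the determinant of the columns e 1 (nu 1), ..., e n (nu n).
   Multiplication by x_i / (1 - a x_i) turns e t c into e t (c+1), and
   e (t+1) (c+1) = e t c + (a + b) e t (c+1).  The power sum times the determinant is therefore the sum
   over the rows j of the determinants in which lam j is replaced by lam j + k.  Each of these is
   straightened in two stages.  First column j is bubbled to the left: every exchange with its
   neighbour produces a sign and the two terms of the recurrence, so the binomial coefficients
   appear; a term stops at row l once its exponent c satisfies lam l < c <= lam (l-1).  Then the
   columns l+1, ..., j, still of the form e (t-1) (lam (t-1)), are rewritten as combinations of
   columns e t q with lam (t-1) < q <= nu (t-1), the expansion being finite because a column equal
   to its left neighbour kills the determinant.  These inequalities say precisely that nu/lam is
   connected with top row l and bottom row j. *)
theory Submission
  imports Defs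
begin

section \<open>Determinants as functions of their columns\<close>

text \<open>The column index comes first, so that \<open>h(t := u)\<close> replaces a whole column;
  both indices run from 1.\<close>

definition col_det :: "nat \<Rightarrow> (nat \<Rightarrow> nat \<Rightarrow> 'a::comm_ring_1) \<Rightarrow> 'a" where
  "col_det n h = det (mat n n (\<lambda>(i, j). h (Suc j) (Suc i)))"

lemma col_det_leibniz:
  "col_det n h = (\<Sum>p | p permutes {0..<n}. signof p * (\<Prod>j<n. h (Suc j) (Suc (p j))))"
proof -
  have "p j < n" if "p permutes {0..<n}" "j < n" for p j
    using permutes_in_image[OF that(1), of j] that(2) by simp
  then show ?thesis
    unfolding col_det_def by (subst det_col[of _ n]) (auto intro!: sum.cong prod.cong)
qed

lemma col_det_transpose: "col_det n h = det (mat n n (\<lambda>(i, j). h (Suc i) (Suc j)))"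
proof -
  have "transpose_mat (mat n n (\<lambda>(i, j). h (Suc i) (Suc j))) = mat n n (\<lambda>(i, j). h (Suc j) (Suc i))"
    by (intro eq_matI) auto
  then show ?thesis
    unfolding col_det_def using det_transpose[of "mat n n (\<lambda>(i, j). h (Suc i) (Suc j))" n] by simp
qed

lemma col_det_swap:
  assumes "t \<in> {1..n}" "t' \<in> {1..n}" "t \<noteq> t'"
  shows "col_det n (h(t := h t', t' := h t)) = - col_det n h"
proof -
  let ?p = "Transposition.transpose (t - 1) (t' - 1)"
  let ?A = "mat n n (\<lambda>(i, j). h (Suc i) (Suc j))"
  have p: "?p permutes {0..<n}"
    using assms by (intro permutes_swap_id) auto
  have "sign ?p = - 1"
    using assms by (subst sign_swap_id) auto
  moreover have "mat n n (\<lambda>(i, j). ?A $$ (?p i, j))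
      = mat n n (\<lambda>(i, j). (h(t := h t', t' := h t)) (Suc i) (Suc j))"
    using assms by (intro eq_matI) (auto simp: Transposition.transpose_def)
  ultimately show ?thesis
    unfolding col_det_transpose using det_permute_rows[OF _ p, of ?A] by simp
qed

lemma col_det_eq_columns:
  assumes "t \<in> {1..n}" "t' \<in> {1..n}" "t \<noteq> t'" "h t = h t'"
  shows "col_det n h = 0"
  unfolding col_det_transpose
proof (rule det_identical_rows[of _ n "t - 1" "t' - 1"])
  show "row (mat n n (\<lambda>(i, j). h (Suc i) (Suc j))) (t - 1)
      = row (mat n n (\<lambda>(i, j). h (Suc i) (Suc j))) (t' - 1)"
    using assms by (intro eq_vecI) auto
qed (use assms in auto)

lemma prod_fun_upd_Suc:
  assumes "t \<in> {1..n}"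
  shows "(\<Prod>j<n. (h(t := u)) (Suc j) (f j))
    = u (f (t - 1)) * (\<Prod>j\<in>{..<n} - {t - 1}. h (Suc j) (f j :: nat) :: 'a::comm_ring_1)"
proof -
  have "(\<Prod>j\<in>{..<n} - {t - 1}. (h(t := u)) (Suc j) (f j))
      = (\<Prod>j\<in>{..<n} - {t - 1}. h (Suc j) (f j))"
    by (rule prod.cong) (use assms in auto)
  moreover have "Suc (t - 1) = t" "t - 1 \<in> {..<n}"
    using assms by auto
  ultimately show ?thesis
    by (subst prod.remove[of _ "t - 1"]) auto
qed

lemma col_det_linear:
  assumes "t \<in> {1..n}"
  shows "col_det n (h(t := \<lambda>i. u i + c * v i)) = col_det n (h(t := u)) + c * col_det n (h(t := v))"
  unfolding col_det_leibniz prod_fun_upd_Suc[OF assms]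
  by (simp add: algebra_simps sum.distrib sum_distrib_left)

text \<open>In the Leibniz term of \<open>p\<close>, scaling column \<open>t\<close> by
  \<open>y\<close> contributes the value of \<open>y\<close> at the row that \<open>p\<close>
  assigns to \<open>t\<close>. As \<open>t\<close> runs over the columns these rows run over all
  rows, so the total factor is the same for every \<open>p\<close>.\<close>

lemma sum_mult_col_det:
  "(\<Sum>i = 1..n. y i) * col_det n h = (\<Sum>t = 1..n. col_det n (h(t := \<lambda>i. y i * h t i)))"
proof -
  have *: "(\<Sum>t = 1..n. (\<Prod>j<n. (h(t := \<lambda>i. y i * h t i)) (Suc j) (Suc (p j))))
      = (\<Sum>i = 1..n. y i) * (\<Prod>j<n. h (Suc j) (Suc (p j)))"
    if p: "p permutes {0..<n}" for p
  proof -
    have "(\<Sum>t = 1..n. (\<Prod>j<n. (h(t := \<lambda>i. y i * h t i)) (Suc j) (Suc (p j))))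
        = (\<Sum>t = 1..n. y (Suc (p (t - 1))) * (\<Prod>j<n. h (Suc j) (Suc (p j))))"
    proof (rule sum.cong)
      fix t assume t: "t \<in> {1..n}"
      then have "Suc (t - 1) = t" "t - 1 \<in> {..<n}"
        by auto
      then show "(\<Prod>j<n. (h(t := \<lambda>i. y i * h t i)) (Suc j) (Suc (p j)))
          = y (Suc (p (t - 1))) * (\<Prod>j<n. h (Suc j) (Suc (p j)))"
        unfolding prod_fun_upd_Suc[OF t] by (subst (2) prod.remove[of _ "t - 1"]) (auto simp: mult.assoc)
    qed simp
    also have "\<dots> = (\<Sum>t = 1..n. y (Suc (p (t - 1)))) * (\<Prod>j<n. h (Suc j) (Suc (p j)))"
      by (simp add: sum_distrib_right)
    also have "(\<Sum>t = 1..n. y (Suc (p (t - 1)))) = (\<Sum>t\<in>{0..<n}. y (Suc (p t)))"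
      by (rule sum.reindex_bij_witness[of _ Suc "\<lambda>t. t - 1"]) auto
    also have "\<dots> = (\<Sum>t\<in>{0..<n}. y (Suc t))"
      using sum.permute[OF p, of "\<lambda>t. y (Suc t)"] by (simp add: o_def)
    also have "\<dots> = (\<Sum>i = 1..n. y i)"
      by (rule sum.reindex_bij_witness[of _ "\<lambda>t. t - 1" Suc]) auto
    finally show ?thesis .
  qed
  have "(\<Sum>t = 1..n. col_det n (h(t := \<lambda>i. y i * h t i))) = (\<Sum>p | p permutes {0..<n}. signof p *
      (\<Sum>t = 1..n. (\<Prod>j<n. (h(t := \<lambda>i. y i * h t i)) (Suc j) (Suc (p j)))))"
    unfolding col_det_leibniz sum_distrib_left by (rule sum.swap)
  also have "\<dots> = (\<Sum>p | p permutes {0..<n}. signof p *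
      ((\<Sum>i = 1..n. y i) * (\<Prod>j<n. h (Suc j) (Suc (p j)))))"
    by (intro sum.cong refl) (simp only: * mem_Collect_eq)
  also have "\<dots> = (\<Sum>i = 1..n. y i) * col_det n h"
    unfolding col_det_leibniz by (simp add: sum_distrib_left mult.left_commute[of "signof _"])
  finally show ?thesis by simp
qed

section \<open>Straightening\<close>

text \<open>Abstracts the columns \<open>e t c\<close> as \<open>g t c\<close>, with
  \<open>\<gamma>\<close> in place of the sum of the two parameters: straightening rests on the
  recurrence and on the monotonicity of \<open>lam\<close>.\<close>

locale column_family =
  fixes n :: nat and g :: "nat \<Rightarrow> nat \<Rightarrow> nat \<Rightarrow> 'a::comm_ring_1" and \<gamma> :: 'a and lam :: "nat \<Rightarrow> nat"
  assumes column_step: "1 \<le> t \<Longrightarrow> t < n \<Longrightarrow> g (Suc t) (Suc c) i = g t c i + \<gamma> * g t (Suc c) i"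
    and lam_Suc_le: "1 \<le> t \<Longrightarrow> t < n \<Longrightarrow> lam (Suc t) \<le> lam t"
begin

text \<open>The numerator of the Grothendieck function, for arbitrary sequences
  \<open>\<nu>\<close>, since raising one part of \<open>lam\<close> can break the order.\<close>

definition alternant :: "(nat \<Rightarrow> nat) \<Rightarrow> 'a" where
  "alternant \<nu> = col_det n (\<lambda>t. g t (\<nu> t))"

text \<open>The state after column \<open>j\<close> has travelled to place \<open>p\<close>: the
  columns \<open>p, ..., j - 1\<close> of \<open>lam\<close> that it passed sit one place too far to
  the right.\<close>

definition shifted :: "nat \<Rightarrow> nat \<Rightarrow> (nat \<Rightarrow> nat) \<Rightarrow> nat \<Rightarrow> nat \<Rightarrow> 'a" where
  "shifted p j a = (\<lambda>t. if p < t \<and> t \<le> j then g (t - 1) (lam (t - 1)) else g t (a t))"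

definition shifted_det :: "nat \<Rightarrow> nat \<Rightarrow> nat \<Rightarrow> 'a" where
  "shifted_det l j c = col_det n (shifted l j (lam(l := c)))"

lemma shifted_self: "shifted j j a = (\<lambda>t. g t (a t))"
  by (auto simp: shifted_def fun_eq_iff)

text \<open>One exchange: the recurrence writes the travelling column at place \<open>Suc l\<close>
  as a combination of two columns of place \<open>l\<close>, and swapping it with its left neighbour
  \<open>g l (lam l)\<close> costs the sign.\<close>

lemma shifted_det_Suc:
  assumes "1 \<le> l" "l < j" "j \<le> n"
  shows "shifted_det (Suc l) j (Suc c) = - (shifted_det l j c + \<gamma> * shifted_det l j (Suc c))"
proof -
  let ?h = "shifted l j lam"
  let ?h' = "?h(l := \<lambda>i. g l c i + \<gamma> * g l (Suc c) i)"
  have upd: "shifted l j (lam(l := d)) = ?h(l := g l d)" for d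
    by (auto simp: shifted_def fun_eq_iff)
  have "shifted (Suc l) j (lam(Suc l := Suc c)) = ?h'(l := ?h' (Suc l), Suc l := ?h' l)"
    using assms by (auto simp: shifted_def fun_eq_iff column_step)
  then have "shifted_det (Suc l) j (Suc c) = - col_det n ?h'"
    unfolding shifted_det_def using assms col_det_swap[of l n "Suc l" ?h'] by simp
  also have "col_det n ?h' = shifted_det l j c + \<gamma> * shifted_det l j (Suc c)"
    unfolding shifted_det_def upd using assms by (intro col_det_linear) auto
  finally show ?thesis .
qed

text \<open>For \<open>l < j\<close> the place \<open>Suc l\<close> holds
  \<open>g l (lam l)\<close>, and the exponent \<open>lam l\<close> at place \<open>l\<close>
  repeats that column.\<close>

lemma shifted_det_vanish:
  assumes "1 \<le> l" "l < j" "j \<le> n"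
  shows "shifted_det l j (lam l) = 0"
  unfolding shifted_det_def
  using assms by (intro col_det_eq_columns[of l _ "Suc l"]) (auto simp: shifted_def)

text \<open>Unsigned weight of reaching exponent \<open>c\<close> from \<open>K\<close> in
  \<open>d\<close> exchanges: each one lowers the exponent by 1 or keeps it at the cost of
  \<open>\<gamma>\<close>, and \<open>c + d - K\<close> of them keep it. The guard matters because
  truncated subtraction would turn impossible cases into 1.\<close>

definition bubble_coeff :: "nat \<Rightarrow> nat \<Rightarrow> nat \<Rightarrow> 'a" where
  "bubble_coeff K d c = (if K \<le> c + d then \<gamma> ^ (c + d - K) * of_nat (d choose (c + d - K)) else 0)"

text \<open>Pascal's rule, by whether the last exchange lowered the exponent from
  \<open>Suc c\<close> or kept it at \<open>c\<close>.\<close>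

lemma bubble_coeff_Suc:
  "bubble_coeff K (Suc d) c = bubble_coeff K d (Suc c) + \<gamma> * bubble_coeff K d c"
proof -
  consider "Suc c + d < K" | "Suc c + d = K" | s where "c + d = K + s"
    by (metis add_Suc le_Suc_ex le_antisym not_less not_less_eq_eq)
  then show ?thesis
    by cases (auto simp: bubble_coeff_def algebra_simps)
qed

text \<open>Downward induction on the place \<open>l\<close> of the travelling column. The sum over
  \<open>m\<close> collects the terms that have stopped, with exponents fitting between
  \<open>lam m\<close> and \<open>lam (m - 1)\<close>; the last sum holds the terms that have
  arrived at place \<open>l\<close>.\<close>

lemma bubble:
  assumes "1 \<le> l" "l \<le> j" "j \<le> n" "lam j < K"
  shows "alternant (lam(j := K)) =
      (\<Sum>m\<in>{l<..j}. (- 1) ^ (j - m) *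
          (\<Sum>c\<in>{lam m<..min (lam (m - 1)) K}. bubble_coeff K (j - m) c * shifted_det m j c))
      + (- 1) ^ (j - l) * (\<Sum>c\<in>{lam l<..K}. bubble_coeff K (j - l) c * shifted_det l j c)"
  using assms(2)
proof (induction rule: inc_induct)
  case base
  have "(\<Sum>c\<in>{lam j<..K}. bubble_coeff K 0 c * shifted_det j j c)
      = (\<Sum>c\<in>{K}. bubble_coeff K 0 c * shifted_det j j c)"
    by (rule sum.mono_neutral_right) (use assms(4) in \<open>auto simp: bubble_coeff_def\<close>)
  then show ?case
    by (simp add: bubble_coeff_def alternant_def shifted_det_def shifted_self)
next
  case (step m)
  let ?T = "\<lambda>l c. shifted_det l j c" and ?B = "bubble_coeff K (j - Suc m)"
  have m: "1 \<le> m" "m < n" "m < j"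
    using step assms by auto
  have d: "j - m = Suc (j - Suc m)"
    using m by simp
  have "(\<Sum>c\<in>{lam m<..K}. ?B c * ?T (Suc m) c)
      = - ((\<Sum>c\<in>{lam m<..K}. ?B c * ?T m (c - 1)) + \<gamma> * (\<Sum>c\<in>{lam m<..K}. ?B c * ?T m c))"
    unfolding sum_distrib_left sum.distrib[symmetric] sum_negf[symmetric]
  proof (rule sum.cong[OF refl])
    fix c assume "c \<in> {lam m<..K}"
    then have "c = Suc (c - 1)"
      by auto
    then show "?B c * ?T (Suc m) c = - (?B c * ?T m (c - 1) + \<gamma> * (?B c * ?T m c))"
      using shifted_det_Suc[OF m(1,3) assms(3), of "c - 1"]
      by (simp only: distrib_left mult_minus_right mult.left_commute[of \<gamma>])
  qed
  also have "(\<Sum>c\<in>{lam m<..K}. ?B c * ?T m (c - 1)) = (\<Sum>c\<in>{lam m..<K}. ?B (Suc c) * ?T m c)"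
    by (rule sum.reindex_bij_witness[of _ Suc "\<lambda>c. c - 1"]) auto
  \<comment> \<open>The two ranges differ only at their ends: at \<open>lam m\<close> the
    determinant has a repeated column, and at \<open>K\<close> the coefficient, taken at
    \<open>Suc K\<close>, is 0 because exchanges never raise the exponent.\<close>
  also have "\<dots> = (\<Sum>c\<in>{lam m<..K}. ?B (Suc c) * ?T m c)"
  proof (rule sum.mono_neutral_cong)
    show "?B (Suc c) * ?T m c = 0" if "c \<in> {lam m..<K} - {lam m<..K}" for c
    proof -
      have "c = lam m"
        using that by auto
      then show ?thesis
        by (simp add: shifted_det_vanish[OF m(1,3) assms(3)])
    qed
    show "?B (Suc c) * ?T m c = 0" if "c \<in> {lam m<..K} - {lam m..<K}" for c
    proof -
      have "c = K"
        using that by auto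
      then show ?thesis
        by (simp add: bubble_coeff_def binomial_eq_0)
    qed
  qed auto
  finally have rest: "(\<Sum>c\<in>{lam m<..K}. ?B c * ?T (Suc m) c)
      = - (\<Sum>c\<in>{lam m<..K}. bubble_coeff K (j - m) c * ?T m c)"
    by (simp add: d bubble_coeff_Suc sum_distrib_left sum.distrib distrib_right mult.assoc)
  \<comment> \<open>Exponents up to \<open>lam m\<close> stop at place \<open>Suc m\<close>; the
    larger ones move on to place \<open>m\<close>.\<close>
  have "{lam (Suc m)<..K} = {lam (Suc m)<..min (lam m) K} \<union> {lam m<..K}"
    using lam_Suc_le[OF m(1,2)] by auto
  then have "(\<Sum>c\<in>{lam (Suc m)<..K}. ?B c * ?T (Suc m) c)
      = (\<Sum>c\<in>{lam (Suc m)<..min (lam m) K}. ?B c * ?T (Suc m) c)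
      + (\<Sum>c\<in>{lam m<..K}. ?B c * ?T (Suc m) c)"
    by (simp only:) (rule sum.union_disjoint, auto)
  then have split: "(\<Sum>c\<in>{lam (Suc m)<..K}. ?B c * ?T (Suc m) c)
      = (\<Sum>c\<in>{lam (Suc m)<..min (lam m) K}. ?B c * ?T (Suc m) c)
      - (\<Sum>c\<in>{lam m<..K}. bubble_coeff K (j - m) c * ?T m c)"
    by (simp only: rest diff_conv_add_uminus)
  have "{m<..j} = insert (Suc m) {Suc m<..j}"
    using m by auto
  then show ?case
    unfolding step.IH split by (simp add: d right_diff_distrib)
qed

text \<open>Index set of the second stage. Row \<open>p\<close> is given by \<open>a\<close>; each
  later row up to \<open>j\<close> must exceed the part of \<open>lam\<close> one row higher, which
  links the two rows, and is at most the part of \<open>\<nu>\<close> one row higher.\<close>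

definition fillings :: "nat \<Rightarrow> nat \<Rightarrow> (nat \<Rightarrow> nat) \<Rightarrow> (nat \<Rightarrow> nat) set" where
  "fillings p j a = {\<nu>. (\<forall>t. t \<notin> {p<..j} \<longrightarrow> \<nu> t = a t) \<and>
     (\<forall>t\<in>{p..<j}. lam t < \<nu> (Suc t) \<and> \<nu> (Suc t) \<le> \<nu> t)}"

text \<open>Solving the recurrence for \<open>g p c\<close> gives a column of place
  \<open>Suc p\<close> and \<open>- \<gamma>\<close> times \<open>g p (Suc c)\<close>. Iteration
  raises \<open>c\<close> until it reaches \<open>b\<close>, where the column equals its left
  neighbour and the determinant vanishes.\<close>

lemma convert_column:
  assumes "1 \<le> p" "p < n" "h p = g p b" "c \<le> b"
  shows "col_det n (h(Suc p := g p c))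
    = (\<Sum>q\<in>{c<..b}. (- \<gamma>) ^ (q - c - 1) * col_det n (h(Suc p := g (Suc p) q)))"
  using assms(4)
proof (induction rule: inc_induct)
  case base
  show ?case
    using assms by (subst col_det_eq_columns[of p _ "Suc p"]) auto
next
  case (step c)
  let ?D = "\<lambda>u. col_det n (h(Suc p := u))"
  have "g p c = (\<lambda>i. g (Suc p) (Suc c) i + (- \<gamma>) * g p (Suc c) i)"
    using assms by (simp add: fun_eq_iff column_step)
  then have "?D (g p c) = ?D (g (Suc p) (Suc c)) + (- \<gamma>) * ?D (g p (Suc c))"
    using assms by (simp only:) (rule col_det_linear, auto)
  also have "\<dots> = ?D (g (Suc p) (Suc c))
      + (\<Sum>q\<in>{Suc c<..b}. (- \<gamma>) ^ (q - c - 1) * ?D (g (Suc p) q))"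
    unfolding step.IH sum_distrib_left
  proof (intro arg_cong2[of _ _ _ _ "(+)"] sum.cong refl)
    fix q assume "q \<in> {Suc c<..b}"
    then have "q - c - 1 = Suc (q - Suc c - 1)"
      by auto
    then show "- \<gamma> * ((- \<gamma>) ^ (q - Suc c - 1) * ?D (g (Suc p) q))
        = (- \<gamma>) ^ (q - c - 1) * ?D (g (Suc p) q)"
      by (simp add: mult.assoc)
  qed
  also have "\<dots> = (\<Sum>q\<in>{c<..b}. (- \<gamma>) ^ (q - c - 1) * ?D (g (Suc p) q))"
  proof -
    have "{c<..b} = insert (Suc c) {Suc c<..b}"
      using step by auto
    then show ?thesis by simp
  qed
  finally show ?case .
qed

text \<open>Branches on the value \<open>q\<close> of the first free row, in step with
  \<open>convert_column\<close>.\<close>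

lemma fillings_rec:
  assumes "p < j"
  shows "fillings p j a = (\<Union>q\<in>{lam p<..a p}. fillings (Suc p) j (a(Suc p := q)))"
proof (intro equalityI subsetI)
  fix \<nu> assume \<nu>: "\<nu> \<in> fillings p j a"
  then have "\<nu> p = a p"
    by (simp add: fillings_def)
  moreover have "p \<in> {p..<j}"
    using assms by simp
  then have "lam p < \<nu> (Suc p)" "\<nu> (Suc p) \<le> \<nu> p"
    using \<nu> unfolding fillings_def by blast+
  ultimately have "\<nu> (Suc p) \<in> {lam p<..a p}"
    by simp
  moreover have "\<nu> \<in> fillings (Suc p) j (a(Suc p := \<nu> (Suc p)))"
    using \<nu> by (auto simp: fillings_def)
  ultimately show "\<nu> \<in> (\<Union>q\<in>{lam p<..a p}. fillings (Suc p) j (a(Suc p := q)))"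
    by blast
next
  fix \<nu> assume "\<nu> \<in> (\<Union>q\<in>{lam p<..a p}. fillings (Suc p) j (a(Suc p := q)))"
  then obtain q where q: "q \<in> {lam p<..a p}" and \<nu>: "\<nu> \<in> fillings (Suc p) j (a(Suc p := q))"
    by blast
  have "\<nu> t = a t" if "t \<notin> {p<..j}" for t
    using \<nu> that assms by (auto simp: fillings_def)
  moreover have "lam t < \<nu> (Suc t) \<and> \<nu> (Suc t) \<le> \<nu> t" if "t \<in> {p..<j}" for t
  proof (cases "t = p")
    case True
    then show ?thesis
      using \<nu> q by (auto simp: fillings_def)
  next
    case False
    then show ?thesis
      using \<nu> that by (auto simp: fillings_def)
  qed
  ultimately show "\<nu> \<in> fillings p j a"
    by (auto simp: fillings_def)
qed

text \<open>The columns \<open>p + 1, ..., j\<close> are converted from left to right, each bounded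
  by the exponent just chosen on its left; the power of \<open>- \<gamma>\<close> accumulates the
  excess of each new part over the least one allowed. Finiteness is carried along in order to merge
  the sums over the branches.\<close>

lemma shifted_expansion:
  assumes "1 \<le> p" "p \<le> j" "j \<le> n" "p < j \<Longrightarrow> lam p < a p"
  shows "finite (fillings p j a) \<and> col_det n (shifted p j a) = (\<Sum>\<nu>\<in>fillings p j a.
      (- \<gamma>) ^ (\<Sum>t = p..<j. \<nu> (Suc t) - lam t - 1) * alternant \<nu>)"
  using assms(2,1,4)
proof (induction arbitrary: a rule: inc_induct)
  case base
  have "fillings j j a = {a}"
    by (auto simp: fillings_def)
  then show ?case
    by (simp add: alternant_def shifted_self)
next
  case (step p)
  let ?F = "\<lambda>q. fillings (Suc p) j (a(Suc p := q))"
  let ?w = "\<lambda>p \<nu>. (\<Sum>t = p..<j. \<nu> (Suc t) - lam t - 1)"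
  have p: "1 \<le> p" "p < n" "p < j"
    using step assms by auto
  \<comment> \<open>Monotonicity of \<open>lam\<close> passes the start condition on to the next
    place.\<close>
  have "lam (Suc p) < q" if "q \<in> {lam p<..a p}" for q
    using lam_Suc_le[OF p(1,2)] that by auto
  then have IH: "finite (?F q)" "col_det n (shifted (Suc p) j (a(Suc p := q))) =
      (\<Sum>\<nu>\<in>?F q. (- \<gamma>) ^ ?w (Suc p) \<nu> * alternant \<nu>)" if "q \<in> {lam p<..a p}" for q
    using step.IH[of "a(Suc p := q)"] that by (simp_all del: fun_upd_apply add: fun_upd_same)
  have at_Suc: "\<nu> (Suc p) = q" if "\<nu> \<in> ?F q" for \<nu> q
    using that by (auto simp: fillings_def)
  have "col_det n (shifted p j a) = col_det n ((shifted p j a)(Suc p := g p (lam p)))"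
    using p by (intro arg_cong[of _ _ "col_det n"]) (auto simp: shifted_def fun_eq_iff)
  also have "\<dots> = (\<Sum>q\<in>{lam p<..a p}.
      (- \<gamma>) ^ (q - lam p - 1) * col_det n ((shifted p j a)(Suc p := g (Suc p) q)))"
    using p step.prems by (intro convert_column) (auto simp: shifted_def intro: less_imp_le)
  also have "\<dots> = (\<Sum>q\<in>{lam p<..a p}. \<Sum>\<nu>\<in>?F q. (- \<gamma>) ^ ?w p \<nu> * alternant \<nu>)"
  proof (rule sum.cong[OF refl])
    fix q assume q: "q \<in> {lam p<..a p}"
    have "(shifted p j a)(Suc p := g (Suc p) q) = shifted (Suc p) j (a(Suc p := q))"
      by (auto simp: shifted_def fun_eq_iff)
    moreover have "?w p \<nu> = (q - lam p - 1) + ?w (Suc p) \<nu>" if "\<nu> \<in> ?F q" for \<nu>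
      using p by (simp add: sum.atLeast_Suc_lessThan at_Suc[OF that])
    ultimately show "(- \<gamma>) ^ (q - lam p - 1) * col_det n ((shifted p j a)(Suc p := g (Suc p) q))
        = (\<Sum>\<nu>\<in>?F q. (- \<gamma>) ^ ?w p \<nu> * alternant \<nu>)"
      by (simp add: IH(2)[OF q] sum_distrib_left power_add mult.assoc)
  qed
  also have "\<dots> = (\<Sum>\<nu>\<in>(\<Union>q\<in>{lam p<..a p}. ?F q). (- \<gamma>) ^ ?w p \<nu> * alternant \<nu>)"
  proof (rule sum.UNION_disjoint[symmetric])
    show "\<forall>q\<in>{lam p<..a p}. \<forall>q'\<in>{lam p<..a p}. q \<noteq> q' \<longrightarrow> ?F q \<inter> ?F q' = {}"
      using at_Suc by blast
  qed (use IH(1) in auto)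
  finally show ?case
    unfolding fillings_rec[OF p(3)] using IH(1) by blast
qed

end

section \<open>Connected skew shapes\<close>

text \<open>For partitions, the arithmetic form of: \<open>nu/lam\<close> is nonempty and connected,
  with top row \<open>l\<close> and bottom row \<open>b\<close>. Rows \<open>t\<close> and
  \<open>t + 1\<close> share a column exactly when \<open>lam t < nu (Suc t)\<close>.\<close>

definition links_rows :: "(nat \<Rightarrow> nat) \<Rightarrow> (nat \<Rightarrow> nat) \<Rightarrow> nat \<Rightarrow> nat \<Rightarrow> bool" where
  "links_rows lam nu l b \<longleftrightarrow> 1 \<le> l \<and> l \<le> b \<and> (\<forall>t. t \<notin> {l..b} \<longrightarrow> nu t = lam t) \<and>
     lam b < nu b \<and> (\<forall>t\<in>{l..<b}. lam t < nu (Suc t))"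

lemma mem_skew: "(i, j) \<in> skew nu lam \<longleftrightarrow> 1 \<le> i \<and> lam i < j \<and> j \<le> nu i"
  by (auto simp: skew_def diagram_def)

lemma partitions_antimono: "lam \<in> partitions n \<Longrightarrow> 1 \<le> i \<Longrightarrow> i \<le> j \<Longrightarrow> lam j \<le> lam i"
  by (cases "j \<le> n") (auto simp: partitions_def)

lemma partitionsI:
  assumes "\<And>t. 1 \<le> t \<Longrightarrow> nu (Suc t) \<le> nu t" "\<And>i. i \<notin> {1..n} \<Longrightarrow> nu i = 0"
  shows "nu \<in> partitions n"
proof -
  have "nu j \<le> nu i" if "1 \<le> i" "i \<le> j" for i j
    using that(2,1)
  proof (induction j rule: dec_induct)
    case (step k)
    then show ?case
      using assms(1)[of k] by simp
  qed simp
  then show ?thesis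
    using assms(2) by (auto simp: partitions_def)
qed

lemma finite_skew:
  assumes "nu \<in> partitions n"
  shows "finite (skew nu lam)"
proof (rule finite_subset)
  show "skew nu lam \<subseteq> (SIGMA i:{1..n}. {..nu i})"
    using assms by (force simp: mem_skew partitions_def)
qed auto

lemma card_skew:
  assumes "nu \<in> partitions n"
  shows "card (skew nu lam) = (\<Sum>i = 1..n. nu i - lam i)"
proof -
  have "skew nu lam = (SIGMA i:{1..n}. {lam i<..nu i})"
    using assms by (force simp: mem_skew partitions_def)
  then show ?thesis
    by (simp add: card_SigmaI)
qed

lemma links_rows_less:
  assumes "links_rows lam nu l b" "nu \<in> partitions n" "l \<le> t" "t \<le> b"
  shows "lam t < nu t"
proof (cases "t = b")
  case False
  then have "lam t < nu (Suc t)" "1 \<le> t"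
    using assms by (auto simp: links_rows_def)
  then show ?thesis
    using partitions_antimono[OF assms(2), of t "Suc t"] by simp
qed (use assms in \<open>auto simp: links_rows_def\<close>)

lemma links_rows_le:
  assumes "links_rows lam nu l b" "nu \<in> partitions n"
  shows "lam \<le> nu"
proof (rule le_funI)
  show "lam t \<le> nu t" for t
    using links_rows_less[OF assms, of t] assms(1)
    by (cases "t \<in> {l..b}") (auto simp: links_rows_def)
qed

lemma links_rows_bound:
  assumes "links_rows lam nu l b" "nu \<in> partitions n"
  shows "b \<le> n"
proof (rule ccontr)
  assume "\<not> b \<le> n"
  then have "nu b = 0"
    using assms(2) by (auto simp: partitions_def)
  then show False
    using assms(1) by (auto simp: links_rows_def)
qed

lemma rows_links_rows:
  assumes "links_rows lam nu l b" "nu \<in> partitions n"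
  shows "fst ` skew nu lam = {l..b}"
proof (intro equalityI subsetI)
  fix t assume "t \<in> fst ` skew nu lam"
  then obtain c where "lam t < c" "c \<le> nu t"
    by (auto simp: mem_skew)
  then have "nu t \<noteq> lam t"
    by simp
  then show "t \<in> {l..b}"
    using assms(1) unfolding links_rows_def by blast
next
  fix t assume "t \<in> {l..b}"
  then have "(t, nu t) \<in> skew nu lam"
    using links_rows_less[OF assms, of t] assms(1) by (auto simp: mem_skew links_rows_def)
  then show "t \<in> fst ` skew nu lam"
    by force
qed

text \<open>Consecutive rows overlap, so the columns they cover leave no gap between
  \<open>lam b\<close> and \<open>nu l\<close>.\<close>

lemma cols_links_rows:
  assumes "links_rows lam nu l b" "nu \<in> partitions n" "lam \<in> partitions n"
  shows "snd ` skew nu lam = {lam b<..nu l}"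
proof (intro equalityI subsetI)
  fix c assume "c \<in> snd ` skew nu lam"
  then obtain t where t: "(t, c) \<in> skew nu lam"
    by force
  then have "t \<in> {l..b}"
    using rows_links_rows[OF assms(1,2)] by force
  then show "c \<in> {lam b<..nu l}"
    using t partitions_antimono[OF assms(2), of l t] partitions_antimono[OF assms(3), of t b] assms(1)
    by (auto simp: mem_skew links_rows_def)
next
  fix c assume c: "c \<in> {lam b<..nu l}"
  \<comment> \<open>The topmost row from \<open>l\<close> on in which \<open>lam\<close> leaves
    column \<open>c\<close> free. If there is a row \<open>s\<close> of the shape above it, then
    \<open>c \<le> lam s\<close> and the link between the two rows puts \<open>c\<close> inside
    \<open>nu\<close>.\<close>
  define t where "t = (LEAST t. l \<le> t \<and> lam t < c)"
  have b: "l \<le> b \<and> lam b < c"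
    using assms(1) c by (auto simp: links_rows_def)
  have t: "l \<le> t" "lam t < c" "t \<le> b"
    using LeastI[of "\<lambda>t. l \<le> t \<and> lam t < c", OF b] Least_le[of "\<lambda>t. l \<le> t \<and> lam t < c", OF b]
    by (auto simp: t_def)
  have "c \<le> nu t"
  proof (cases "t = l")
    case False
    then obtain s where s: "t = Suc s" "l \<le> s" "s < b"
      using t by (cases t) auto
    then have "\<not> lam s < c"
      using not_less_Least[of s "\<lambda>t. l \<le> t \<and> lam t < c"] by (auto simp: t_def)
    moreover have "lam s < nu t"
      using assms(1) s by (auto simp: links_rows_def)
    ultimately show ?thesis
      by simp
  qed (use c in auto)
  then have "(t, c) \<in> skew nu lam"
    using t assms(1) by (auto simp: mem_skew links_rows_def)
  then show "c \<in> snd ` skew nu lam"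
    by force
qed

lemma num_rows_links_rows:
  "links_rows lam nu l b \<Longrightarrow> nu \<in> partitions n \<Longrightarrow> num_rows (skew nu lam) = Suc b - l"
  by (simp add: num_rows_def rows_links_rows)

lemma num_cols_links_rows:
  "links_rows lam nu l b \<Longrightarrow> nu \<in> partitions n \<Longrightarrow> lam \<in> partitions n \<Longrightarrow>
    num_cols (skew nu lam) = nu l - lam b"
  by (simp add: num_cols_def cols_links_rows)

text \<open>Pairs \<open>nu (Suc t)\<close> with \<open>lam t\<close> instead of \<open>nu t\<close>
  with \<open>lam t\<close>, which leaves \<open>nu l\<close> and \<open>lam b\<close> over. Each
  pair differs by at least 1: the ones add up to \<open>b - l\<close>, and the rest is the exponent
  occurring in \<open>shifted_expansion\<close>.\<close>

lemma card_links_rows: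
  assumes "links_rows lam nu l b" "nu \<in> partitions n" "lam \<in> partitions n"
  shows "card (skew nu lam) = nu l - lam b + (b - l) + (\<Sum>t = l..<b. nu (Suc t) - lam t - 1)"
proof -
  have l: "1 \<le> l" "l \<le> b"
    using assms(1) by (auto simp: links_rows_def)
  have b: "b \<le> n"
    by (rule links_rows_bound[OF assms(1,2)])
  have "nu t - lam t = 0" if "t \<in> {1..n} - {l..b}" for t
    using that assms(1) by (auto simp: links_rows_def)
  then have "card (skew nu lam) = (\<Sum>t = l..b. nu t - lam t)"
    unfolding card_skew[OF assms(2)] using l b by (intro sum.mono_neutral_right) auto
  then have "int (card (skew nu lam)) = (\<Sum>t = l..b. int (nu t) - int (lam t))"
    using le_funD[OF links_rows_le[OF assms(1,2)]] by (simp add: of_nat_diff)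
  also have "\<dots> = (int (nu l) + (\<Sum>t = l..<b. int (nu (Suc t))))
      - ((\<Sum>t = l..<b. int (lam t)) + int (lam b))"
  proof -
    have "(\<Sum>t = l..b. int (nu t)) = int (nu l) + (\<Sum>t = Suc l..<Suc b. int (nu t))"
      using l by (simp add: sum.atLeast_Suc_atMost atLeastLessThanSuc_atLeastAtMost)
    then have "(\<Sum>t = l..b. int (nu t)) = int (nu l) + (\<Sum>t = l..<b. int (nu (Suc t)))"
      by (simp only: sum.shift_bounds_Suc_ivl)
    moreover have "(\<Sum>t = l..b. int (lam t)) = (\<Sum>t = l..<b. int (lam t)) + int (lam b)"
      using l by (simp flip: atLeastLessThanSuc_atLeastAtMost)
    ultimately show ?thesis
      by (simp add: sum_subtractf)
  qed
  also have "\<dots> = int (nu l) - int (lam b) + (\<Sum>t = l..<b. int (nu (Suc t)) - int (lam t))"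
    by (simp add: sum_subtractf)
  also have "(\<Sum>t = l..<b. int (nu (Suc t)) - int (lam t))
      = (\<Sum>t = l..<b. 1 + int (nu (Suc t) - lam t - 1))"
  proof (rule sum.cong[OF refl])
    fix t assume "t \<in> {l..<b}"
    then have "lam t < nu (Suc t)"
      using assms(1) by (auto simp: links_rows_def)
    then show "int (nu (Suc t)) - int (lam t) = 1 + int (nu (Suc t) - lam t - 1)"
      by simp
  qed
  also have "\<dots> = int (b - l) + int (\<Sum>t = l..<b. nu (Suc t) - lam t - 1)"
    by (simp add: sum.distrib)
  also have "int (nu l) - int (lam b) = int (nu l - lam b)"
  proof -
    have "lam b \<le> nu l"
      using l assms(1) partitions_antimono[OF assms(2), of l b] by (auto simp: links_rows_def)
    then show ?thesis by simp
  qed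
  finally show ?thesis by linarith
qed

text \<open>Every box is joined to the end of row \<open>b\<close>: walk along row \<open>t\<close>
  to column \<open>lam t + 1\<close>, which row \<open>t + 1\<close> also contains, and step
  down.\<close>

lemma links_rows_connected:
  assumes "links_rows lam nu l b" "nu \<in> partitions n" "lam \<in> partitions n"
  shows "connected_shape (skew nu lam)"
proof -
  let ?S = "skew nu lam"
  let ?R = "\<lambda>p q. p \<in> ?S \<and> q \<in> ?S \<and> adjacent p q"
  have sym: "?R\<^sup>*\<^sup>* q p" if "?R\<^sup>*\<^sup>* p q" for p q
  proof -
    have "symp ?R"
      by (auto simp: symp_def adjacent_def)
    then show ?thesis
      using that by (metis (no_types, lifting) symp_rtranclp sympD)
  qed
  have row: "?R\<^sup>*\<^sup>* (t, c) (t, c + d)" if "(t, c) \<in> ?S" "(t, c + d) \<in> ?S" for t c d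
    using that(2)
  proof (induction d)
    case (Suc d)
    then have mem: "(t, c + d) \<in> ?S"
      using that(1) by (auto simp: mem_skew)
    then have "?R (t, c + d) (t, c + Suc d)"
      using Suc.prems by (auto simp: adjacent_def)
    with Suc.IH[OF mem] show ?case
      by (rule rtranclp.rtrancl_into_rtrancl)
  qed simp
  have row': "?R\<^sup>*\<^sup>* (t, c) (t, c')" if "(t, c) \<in> ?S" "(t, c') \<in> ?S" for t c c'
  proof (cases "c \<le> c'")
    case True
    then show ?thesis
      using row[of t c "c' - c"] that by simp
  next
    case False
    then show ?thesis
      using sym[OF row[of t c' "c - c'"]] that by simp
  qed
  have to_b: "?R\<^sup>*\<^sup>* (t, c) (b, nu b)" if "t \<le> b" "(t, c) \<in> ?S" for t c
    using that
  proof (induction arbitrary: c rule: inc_induct)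
    case base
    then show ?case
      using row'[of b c "nu b"] assms(1) by (auto simp: mem_skew links_rows_def)
  next
    case (step t)
    have t: "l \<le> t" "1 \<le> t"
      using imageI[OF step.prems, of fst] rows_links_rows[OF assms(1,2)] assms(1)
      by (auto simp: links_rows_def)
    then have "lam t < nu (Suc t)"
      using assms(1) step.hyps by (auto simp: links_rows_def)
    moreover have "nu (Suc t) \<le> nu t" "lam (Suc t) \<le> lam t"
      using partitions_antimono[OF assms(2), of t "Suc t"]
        partitions_antimono[OF assms(3), of t "Suc t"] t by auto
    ultimately have mem: "(t, Suc (lam t)) \<in> ?S" "(Suc t, Suc (lam t)) \<in> ?S"
      using t by (auto simp: mem_skew)
    have "?R (t, Suc (lam t)) (Suc t, Suc (lam t))"
      using mem by (auto simp: adjacent_def)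
    with row'[OF step.prems mem(1)] have "?R\<^sup>*\<^sup>* (t, c) (Suc t, Suc (lam t))"
      by (rule rtranclp.rtrancl_into_rtrancl)
    then show ?case
      using step.IH[OF mem(2)] by (rule rtranclp_trans)
  qed
  have to_b': "?R\<^sup>*\<^sup>* p (b, nu b)" if "p \<in> ?S" for p
  proof -
    have "fst p \<le> b"
      using rows_links_rows[OF assms(1,2)] that by force
    then show ?thesis
      using to_b[of "fst p" "snd p"] that by simp
  qed
  show ?thesis
    unfolding connected_shape_def
  proof (intro ballI)
    fix p q assume "p \<in> ?S" "q \<in> ?S"
    then show "?R\<^sup>*\<^sup>* p q"
      using rtranclp_trans[OF to_b' sym[OF to_b']] by simp
  qed
qed

text \<open>Take the extreme rows for \<open>l\<close> and \<open>b\<close>. If rows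
  \<open>t\<close> and \<open>t + 1\<close> between them shared no column, a path starting in row
  \<open>l\<close> could never get below row \<open>t\<close>.\<close>

lemma connected_links_rows:
  assumes "connected_shape (skew nu lam)" "skew nu lam \<noteq> {}" "lam \<le> nu" "nu \<in> partitions n"
  obtains l b where "links_rows lam nu l b"
proof -
  let ?S = "skew nu lam"
  let ?R = "\<lambda>p q. p \<in> ?S \<and> q \<in> ?S \<and> adjacent p q"
  define l where "l = Min (fst ` ?S)"
  define b where "b = Max (fst ` ?S)"
  have fin: "finite (fst ` ?S)" "fst ` ?S \<noteq> {}"
    using finite_skew[OF assms(4)] assms(2) by auto
  obtain c where c: "(l, c) \<in> ?S"
    using Min_in[OF fin] by (auto simp: l_def)
  obtain d where d: "(b, d) \<in> ?S"
    using Max_in[OF fin] by (auto simp: b_def)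
  have off: "nu t = lam t" if "t \<notin> {l..b}" for t
  proof (rule ccontr)
    assume "nu t \<noteq> lam t"
    then have less: "lam t < nu t"
      using assms(3) by (auto simp: le_fun_def le_less)
    then have "t \<noteq> 0"
      using assms(4) by (cases "t = 0") (auto simp: partitions_def dest: spec[of _ 0])
    then have "(t, nu t) \<in> ?S"
      using less by (auto simp: mem_skew)
    then have "t \<in> fst ` ?S"
      by force
    then show False
      using that fin Min_le[of "fst ` ?S" t] Max_ge[of "fst ` ?S" t] by (auto simp: l_def b_def)
  qed
  have "lam t < nu (Suc t)" if t: "t \<in> {l..<b}" for t
  proof (rule ccontr)
    assume gap: "\<not> lam t < nu (Suc t)"
    have "fst p \<le> t" if "?R\<^sup>*\<^sup>* (l, c) p" for p
      using that
    proof (induction rule: rtranclp_induct)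
      case base
      then show ?case
        using t by simp
    next
      case (step p q)
      obtain i x where p: "p = (i, x)"
        by (cases p)
      obtain i' x' where q: "q = (i', x')"
        by (cases q)
      have "\<not> (i = t \<and> i' = Suc t \<and> x = x')"
        using step.hyps gap unfolding p q by (auto simp: mem_skew)
      then show ?case
        using step unfolding p q by (auto simp: adjacent_def)
    qed
    moreover have "?R\<^sup>*\<^sup>* (l, c) (b, d)"
      using assms(1) c d by (auto simp: connected_shape_def)
    ultimately show False
      using t by fastforce
  qed
  moreover have "1 \<le> l" "lam b < nu b" "l \<le> b"
    using c d fin by (auto simp: mem_skew l_def b_def)
  ultimately have "links_rows lam nu l b"
    using off by (auto simp: links_rows_def)
  then show thesis
    by (rule that)
qed

text \<open>A linked shape without a 2 by 2 square has columns plus rows minus 1 boxes, and neither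
  count exceeds that of \<open>nu/lam\<close>; an explicit \<open>mu\<close> attains the
  bound.\<close>

lemma nw_ribbon_size_links_rows:
  assumes "links_rows lam nu l b" "nu \<in> partitions n" "lam \<in> partitions n"
  shows "nw_ribbon_size n nu lam = nu l - lam b + (b - l)"
  unfolding nw_ribbon_size_def
proof (rule Max_eqI)
  let ?C = "{card (skew mu lam) |mu. mu \<in> partitions n \<and> lam \<le> mu \<and> mu \<le> nu \<and> ribbon (skew mu lam)}"
  have lb: "1 \<le> l" "l \<le> b"
    using assms(1) by (auto simp: links_rows_def)
  have "?C \<subseteq> {..card (skew nu lam)}"
  proof
    fix y assume "y \<in> ?C"
    then obtain mu where "y = card (skew mu lam)" "mu \<le> nu"
      by blast
    moreover from this have "skew mu lam \<subseteq> skew nu lam"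
      by (auto simp: skew_def diagram_def dest: le_funD intro: le_trans)
    ultimately show "y \<in> {..card (skew nu lam)}"
      using finite_skew[OF assms(2)] by (simp add: card_mono)
  qed
  then show "finite ?C"
    using finite_subset by blast
  show "y \<le> nu l - lam b + (b - l)" if y: "y \<in> ?C" for y
  proof -
    from y obtain mu where mu: "y = card (skew mu lam)" "mu \<in> partitions n" "lam \<le> mu" "mu \<le> nu"
      "ribbon (skew mu lam)"
      by blast
    show ?thesis
    proof (cases "skew mu lam = {}")
      case False
      then obtain l' b' where link: "links_rows lam mu l' b'"
        using connected_links_rows[OF _ False mu(3,2)] mu(5) by (auto simp: ribbon_def)
      \<comment> \<open>An excess here would make rows \<open>t\<close> and \<open>Suc t\<close>
        share the columns \<open>lam t + 1\<close> and \<open>lam t + 2\<close>, hence contain a 2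
        by 2 square.\<close>
      have "mu (Suc t) - lam t - 1 = 0" if t: "t \<in> {l'..<b'}" for t
      proof (rule ccontr)
        assume *: "\<not> ?thesis"
        have "1 \<le> t"
          using link t by (auto simp: links_rows_def)
        then have "mu (Suc t) \<le> mu t" "lam (Suc t) \<le> lam t"
          using partitions_antimono[OF mu(2), of t "Suc t"]
            partitions_antimono[OF assms(3), of t "Suc t"] by auto
        then have "{(t, lam t + 1), (t + 1, lam t + 1), (t, lam t + 1 + 1), (t + 1, lam t + 1 + 1)}
            \<subseteq> skew mu lam"
          using * \<open>1 \<le> t\<close> by (auto simp: mem_skew)
        then show False
          using mu(5) unfolding ribbon_def by blast
      qed
      then have y: "y = mu l' - lam b' + (b' - l')"
        using card_links_rows[OF link mu(2) assms(3)] mu(1) by simp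
      have l'b': "1 \<le> l'" "l' \<le> b'" "lam b' < mu b'" "lam l' < mu l'"
        using link links_rows_less[OF link mu(2), of l'] by (auto simp: links_rows_def)
      have "lam l' < nu l'" "lam b' < nu b'"
        using l'b' le_funD[OF mu(4), of l'] le_funD[OF mu(4), of b'] by auto
      then have "l' \<in> {l..b}" "b' \<in> {l..b}"
        using assms(1) unfolding links_rows_def by (metis less_irrefl)+
      then have in_lb: "l \<le> l'" "b' \<le> b"
        by auto
      have "mu l' \<le> nu l"
        using partitions_antimono[OF assms(2) lb(1) in_lb(1)] le_funD[OF mu(4), of l'] by simp
      moreover have "lam b \<le> lam b'"
        using partitions_antimono[OF assms(3) _ in_lb(2)] l'b' by simp
      ultimately show ?thesis
        unfolding y using in_lb by (intro add_mono diff_le_mono diff_le_mono2) auto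
    qed (use mu(1) in simp)
  qed
  \<comment> \<open>The maximal ribbon: the top row is that of \<open>nu\<close>, and every lower
    row ends just beneath the first box of the row above, so that consecutive rows share one column
    only.\<close>
  define mu where "mu = (\<lambda>t. if t = l then nu l else if t \<in> {l<..b} then Suc (lam (t - 1)) else lam t)"
  have mu_nu: "mu t \<le> nu t" and lam_mu: "lam t \<le> mu t" for t
  proof -
    show "mu t \<le> nu t"
    proof (cases "t \<in> {l<..b}")
      case True
      then obtain s where "t = Suc s" "s \<in> {l..<b}"
        by (cases t) auto
      then show ?thesis
        using assms(1) by (auto simp: mu_def links_rows_def Suc_le_eq)
    qed (use links_rows_le[OF assms(1,2)] in \<open>auto simp: mu_def le_fun_def\<close>)
    have "lam t \<le> lam (t - 1)" if "l < t"
      using partitions_antimono[OF assms(3), of "t - 1" t] that lb by auto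
    then show "lam t \<le> mu t"
      using links_rows_le[OF assms(1,2)] by (auto simp: mu_def le_fun_def)
  qed
  have mu: "mu \<in> partitions n"
  proof (rule partitionsI)
    show "mu (Suc t) \<le> mu t" if "1 \<le> t" for t
    proof -
      consider "Suc t < l" | "Suc t = l" | "t = l" "t < b" | "t = b" | "l < t" "t < b" | "b < t"
        using lb by linarith
      then show ?thesis
      proof cases
        case 1
        then show ?thesis
          using partitions_antimono[OF assms(3), of t "Suc t"] that by (auto simp: mu_def)
      next
        case 2
        then have "nu t = lam t"
          using assms(1) by (auto simp: links_rows_def)
        then show ?thesis
          using partitions_antimono[OF assms(2), of t "Suc t"] that 2 by (auto simp: mu_def)
      next
        case 3
        then show ?thesis
          using links_rows_less[OF assms(1,2), of l] lb by (auto simp: mu_def)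
      next
        case 4
        then have "mu (Suc t) = lam (Suc t)"
          using lb by (auto simp: mu_def)
        also have "\<dots> \<le> lam t"
          using partitions_antimono[OF assms(3), of t "Suc t"] that by simp
        finally show ?thesis
          using lam_mu[of t] by simp
      next
        case 5
        then show ?thesis
          using partitions_antimono[OF assms(3), of "t - 1" t] lb by (auto simp: mu_def)
      next
        case 6
        then show ?thesis
          using partitions_antimono[OF assms(3), of t "Suc t"] lb by (auto simp: mu_def)
      qed
    qed
    show "mu i = 0" if "i \<notin> {1..n}" for i
      using mu_nu[of i] assms(2) that by (auto simp: partitions_def)
  qed
  have link: "links_rows lam mu l b"
    unfolding links_rows_def
  proof (intro conjI allI impI ballI)
    show "lam b < mu b"
      using links_rows_less[OF assms(1,2), of b] lb partitions_antimono[OF assms(3), of "b - 1" b]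
      by (cases "b = l") (auto simp: mu_def less_Suc_eq_le)
  qed (use lb in \<open>auto simp: mu_def\<close>)
  have "ribbon (skew mu lam)"
    unfolding ribbon_def
  proof (intro conjI notI)
    show "connected_shape (skew mu lam)"
      by (rule links_rows_connected[OF link mu assms(3)])
    assume "\<exists>i j. {(i, j), (i + 1, j), (i, j + 1), (i + 1, j + 1)} \<subseteq> skew mu lam"
    then obtain i j where ij: "(i, j) \<in> skew mu lam" "(Suc i, Suc j) \<in> skew mu lam"
      by auto
    then have "{i, Suc i} \<subseteq> {l..b}"
      unfolding rows_links_rows[OF link mu, symmetric] by force
    \<comment> \<open>Row \<open>i\<close> starts to the right of column \<open>lam i\<close>, so
      column \<open>Suc j\<close> lies beyond the end of row \<open>Suc i\<close>.\<close>
    then have "mu (Suc i) = Suc (lam i)"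
      by (auto simp: mu_def)
    then show False
      using ij by (auto simp: mem_skew)
  qed
  moreover have "card (skew mu lam) = nu l - lam b + (b - l)"
  proof -
    have "(\<Sum>t = l..<b. mu (Suc t) - lam t - 1) = 0"
      by (auto simp: mu_def)
    then show ?thesis
      using card_links_rows[OF link mu assms(3)] by (simp add: mu_def)
  qed
  ultimately show "nu l - lam b + (b - l) \<in> ?C"
    using mu mu_nu lam_mu by (intro CollectI exI[of _ mu]) (auto simp: le_fun_def)
qed

section \<open>The Pieri rule\<close>

context column_family
begin

text \<open>The stopping condition on \<open>c\<close> keeps \<open>\<nu>\<close> weakly decreasing
  from row \<open>l - 1\<close> to row \<open>l\<close>; the bounds in \<open>fillings\<close> do so
  further down and link the rows.\<close>

lemma fillings_links_rows:
  assumes "lam \<in> partitions n" "\<nu> \<in> fillings l b (lam(l := c))"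
    and "1 \<le> l" "l \<le> b" "b \<le> n" "lam l < c" "1 < l \<Longrightarrow> c \<le> lam (l - 1)"
  shows "\<nu> \<in> partitions n" "links_rows lam \<nu> l b" "\<nu> l = c"
proof -
  have off: "\<nu> t = lam t" if "t \<notin> {l..b}" for t
    using assms(2,4) that by (force simp: fillings_def)
  have at_l: "\<nu> l = c"
    using assms(2) by (simp add: fillings_def)
  have inside: "lam t < \<nu> (Suc t)" "\<nu> (Suc t) \<le> \<nu> t" if "t \<in> {l..<b}" for t
    using assms(2) that by (auto simp: fillings_def)
  have at_b: "lam b < \<nu> b"
  proof (cases "b = l")
    case False
    then obtain s where "b = Suc s" "l \<le> s"
      using assms(4) by (cases b) auto
    then show ?thesis
      using inside(1)[of s] partitions_antimono[OF assms(1), of s b] assms(3) by auto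
  qed (use at_l assms(6) in simp)
  show "\<nu> l = c"
    by (rule at_l)
  show "links_rows lam \<nu> l b"
    using assms(3,4) at_b inside off by (simp add: links_rows_def)
  show "\<nu> \<in> partitions n"
  proof (rule partitionsI)
    show "\<nu> (Suc t) \<le> \<nu> t" if t: "1 \<le> t" for t
    proof -
      note mono = partitions_antimono[OF assms(1) t, of "Suc t"]
      consider "Suc t < l \<or> b < t" | "Suc t = l" | "l \<le> t" "t < b" | "t = b"
        by linarith
      then show ?thesis
      proof cases
        case 1
        then show ?thesis
          using off[of t] off[of "Suc t"] mono by auto
      next
        case 2
        then have "\<nu> t = lam t"
          by (intro off) auto
        then show ?thesis
          using 2 at_l assms(7) t by auto
      next
        case 3
        then show ?thesis
          using inside by auto
      next
        case 4
        then have "\<nu> (Suc t) = lam (Suc t)"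
          by (intro off) auto
        then show ?thesis
          using at_b mono 4 by simp
      qed
    qed
    show "\<nu> i = 0" if "i \<notin> {1..n}" for i
      using off[of i] assms(1,3,5) that by (auto simp: partitions_def)
  qed
qed

text \<open>The converse: above row \<open>l\<close> the shape agrees with \<open>lam\<close>, which
  gives back the stopping condition.\<close>

lemma links_rows_fillings:
  assumes "links_rows lam \<nu> l b" "\<nu> \<in> partitions n"
  shows "\<nu> \<in> fillings l b (lam(l := \<nu> l))" "1 < l \<Longrightarrow> \<nu> l \<le> lam (l - 1)"
proof -
  have "\<nu> (Suc t) \<le> \<nu> t" if "t \<in> {l..<b}" for t
    using partitions_antimono[OF assms(2), of t "Suc t"] assms(1) that by (auto simp: links_rows_def)
  then show "\<nu> \<in> fillings l b (lam(l := \<nu> l))"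
    using assms(1) by (auto simp: fillings_def links_rows_def)
  assume "1 < l"
  then have "\<nu> (l - 1) = lam (l - 1)"
    using assms(1) by (auto simp: links_rows_def)
  then show "\<nu> l \<le> lam (l - 1)"
    using partitions_antimono[OF assms(2), of "l - 1" l] \<open>1 < l\<close> by simp
qed

text \<open>Of the \<open>d\<close> exchanges, \<open>K - c\<close> lower the exponent and each of
  the others carries a factor \<open>\<gamma>\<close>, which absorbs its sign into
  \<open>- \<gamma>\<close>.\<close>

lemma bubble_coeff_sign:
  assumes "K \<le> c + d" "c \<le> K"
  shows "(- 1) ^ d * (bubble_coeff K d c * (- \<gamma>) ^ e)
    = (- \<gamma>) ^ (e + (c + d - K)) * (- 1) ^ (K - c) * of_nat (d choose (K - c))"
proof -
  define s where "s = c + d - K"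
  have d: "d = s + (K - c)"
    using assms by (simp add: s_def)
  have "(- 1 :: 'a) ^ d = (- 1) ^ s * (- 1) ^ (K - c)"
    by (subst d) (rule power_add)
  moreover have "d choose s = d choose (K - c)"
    using binomial_symmetric[of s d] d by simp
  moreover have "bubble_coeff K d c = \<gamma> ^ s * of_nat (d choose s)"
    using assms by (simp add: bubble_coeff_def s_def)
  moreover have "(- \<gamma>) ^ s = (- 1) ^ s * \<gamma> ^ s"
    by (rule power_minus)
  ultimately show ?thesis
    unfolding s_def[symmetric] by (simp only: power_add mult_ac)
qed

text \<open>A shape with rows \<open>m..j\<close> and top part \<open>c\<close> arises only from
  column \<open>j\<close> stopping at place \<open>m\<close> with exponent \<open>c\<close>, so no
  two terms combine. There \<open>c \<le> lam j + k\<close> bounds the columns by \<open>k\<close>,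
  and \<open>lam j + k \<le> c + (j - m)\<close> gives the ribbon at least \<open>k\<close>
  boxes.\<close>

lemma power_sum_mult_alternant:
  assumes "lam \<in> partitions n" "1 \<le> k"
    and mult: "\<And>t c i. 1 \<le> t \<Longrightarrow> t \<le> n \<Longrightarrow> y i * g t c i = g t (Suc c) i"
  shows "(\<Sum>i = 1..n. y i ^ k) * alternant lam =
    (\<Sum>\<nu>\<in>{\<nu> \<in> partitions n. lam \<le> \<nu> \<and> num_cols (skew \<nu> lam) \<le> k \<and>
        connected_shape (skew \<nu> lam) \<and> k \<le> nw_ribbon_size n \<nu> lam}.
      (- \<gamma>) ^ (card (skew \<nu> lam) - k) * (- 1) ^ (k - num_cols (skew \<nu> lam)) *
      of_nat ((num_rows (skew \<nu> lam) - 1) choose (k - num_cols (skew \<nu> lam))) * alternant \<nu>)"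
    (is "_ = sum ?f ?S")
proof -
  let ?F = "\<lambda>j m c. fillings m j (lam(m := c))"
  \<comment> \<open>Exponents with which the column from row \<open>j\<close> stops at row
    \<open>m\<close>; for row 1 there is no part above to bound them.\<close>
  define C where "C j m = {c \<in> {lam m<..lam j + k}. 1 < m \<longrightarrow> c \<le> lam (m - 1)}" for j m
  \<comment> \<open>Discards the exponents that the guard in \<open>bubble_coeff\<close> sends to
    0.\<close>
  define D where "D j m = {c \<in> C j m. lam j + k \<le> c + (j - m)}" for j m
  have fin: "finite (C j m)" "finite (D j m)" for j m
    by (auto simp: C_def D_def)
  have pow: "y i ^ m * g t c i = g t (c + m) i" if "1 \<le> t" "t \<le> n" for t c i m
    by (induction m) (simp_all add: mult.assoc mult[OF that])
  have expand: "shifted_det m j c = (\<Sum>\<nu>\<in>?F j m c.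
      (- \<gamma>) ^ (\<Sum>t = m..<j. \<nu> (Suc t) - lam t - 1) * alternant \<nu>)" "finite (?F j m c)"
    if "j \<in> {1..n}" "m \<in> {1..j}" "c \<in> C j m" for j m c
    using shifted_expansion[of m j "lam(m := c)"] that by (auto simp: shifted_det_def C_def)
  have weight: "(- 1) ^ (j - m) * (bubble_coeff (lam j + k) (j - m) c *
      ((- \<gamma>) ^ (\<Sum>t = m..<j. \<nu> (Suc t) - lam t - 1) * alternant \<nu>)) = ?f \<nu>"
    and in_S: "\<nu> \<in> ?S" and link: "links_rows lam \<nu> m j" and at_m: "\<nu> m = c"
    if "j \<in> {1..n}" "m \<in> {1..j}" "c \<in> D j m" "\<nu> \<in> ?F j m c" for j m c \<nu>
  proof -
    have \<nu>: "\<nu> \<in> partitions n" "links_rows lam \<nu> m j" "\<nu> m = c"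
      using fillings_links_rows[OF assms(1) that(4)] that(1,2,3) by (auto simp: C_def D_def)
    have c: "lam j + k \<le> c + (j - m)" "c \<le> lam j + k"
      using that(3) by (auto simp: C_def D_def)
    have "lam j \<le> lam m" "lam m < c"
      using partitions_antimono[OF assms(1), of m j] that by (auto simp: C_def D_def)
    then have lc: "lam j < c"
      by simp
    have cols: "num_cols (skew \<nu> lam) = c - lam j"
      using num_cols_links_rows[OF \<nu>(2,1) assms(1)] \<nu>(3) by simp
    have rows: "num_rows (skew \<nu> lam) - 1 = j - m"
      using num_rows_links_rows[OF \<nu>(2,1)] that(2) by simp
    have card: "card (skew \<nu> lam) - k =
        (\<Sum>t = m..<j. \<nu> (Suc t) - lam t - 1) + (c + (j - m) - (lam j + k))"
      using card_links_rows[OF \<nu>(2,1) assms(1)] \<nu>(3) c lc by simp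
    have kc: "k - (c - lam j) = lam j + k - c"
      using c lc by simp
    show "links_rows lam \<nu> m j" "\<nu> m = c"
      by (rule \<nu>)+
    show "\<nu> \<in> ?S"
      using \<nu> c lc cols links_rows_le[OF \<nu>(2,1)] links_rows_connected[OF \<nu>(2,1) assms(1)]
        nw_ribbon_size_links_rows[OF \<nu>(2,1) assms(1)] by auto
    show "(- 1) ^ (j - m) * (bubble_coeff (lam j + k) (j - m) c *
      ((- \<gamma>) ^ (\<Sum>t = m..<j. \<nu> (Suc t) - lam t - 1) * alternant \<nu>)) = ?f \<nu>"
      unfolding cols rows card kc bubble_coeff_sign[OF c, symmetric] by (simp add: mult.assoc)
  qed
  have onto: "\<exists>j m. j \<in> {1..n} \<and> m \<in> {1..j} \<and> \<nu> m \<in> D j m \<and> \<nu> \<in> ?F j m (\<nu> m)"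
    if \<nu>: "\<nu> \<in> ?S" for \<nu>
  proof -
    \<comment> \<open>The empty shape counts as connected and has no columns, but its ribbon size is
      0, below \<open>k\<close>.\<close>
    have "skew \<nu> lam \<noteq> {}"
    proof
      assume "skew \<nu> lam = {}"
      moreover have "skew \<mu> lam \<subseteq> skew \<nu> lam" if "\<mu> \<le> \<nu>" for \<mu>
        using that by (auto simp: skew_def diagram_def dest: le_funD intro: le_trans)
      ultimately have "{card (skew \<mu> lam) |\<mu>. \<mu> \<in> partitions n \<and> lam \<le> \<mu> \<and> \<mu> \<le> \<nu> \<and> ribbon (skew \<mu> lam)} = {0}"
        using \<nu> assms(1) by (auto simp: ribbon_def connected_shape_def intro!: exI[of _ \<nu>])
      then show False
        using \<nu> assms(2) by (simp add: nw_ribbon_size_def)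
    qed
    then obtain l b where link: "links_rows lam \<nu> l b"
      using connected_links_rows \<nu> by blast
    have p: "\<nu> \<in> partitions n"
      using \<nu> by simp
    have "1 \<le> l" "l \<le> b" "b \<le> n" "lam l < \<nu> l"
      using link links_rows_bound[OF link p] links_rows_less[OF link p, of l]
      by (auto simp: links_rows_def)
    moreover from this have "lam b < \<nu> l"
      using partitions_antimono[OF assms(1), of l b] by simp
    ultimately have "\<nu> l \<in> D b l"
      using \<nu> num_cols_links_rows[OF link p assms(1)] nw_ribbon_size_links_rows[OF link p assms(1)]
        links_rows_fillings(2)[OF link p] by (auto simp: C_def D_def)
    then show ?thesis
      using \<open>1 \<le> l\<close> \<open>l \<le> b\<close> \<open>b \<le> n\<close> links_rows_fillings(1)[OF link p] by (intro exI[of _ b] exI[of _ l]) auto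
  qed
  have "(\<Sum>i = 1..n. y i ^ k) * alternant lam = (\<Sum>j = 1..n. alternant (lam(j := lam j + k)))"
    unfolding alternant_def sum_mult_col_det
    by (intro sum.cong refl arg_cong[of _ _ "col_det n"]) (auto simp: fun_eq_iff pow)
  also have "\<dots> = (\<Sum>j = 1..n. \<Sum>m = 1..j. (- 1) ^ (j - m) *
      (\<Sum>c\<in>C j m. bubble_coeff (lam j + k) (j - m) c * shifted_det m j c))"
  proof (rule sum.cong[OF refl])
    fix j assume j: "j \<in> {1..n}"
    \<comment> \<open>At place 1 there is nothing left to pass, so the last sum of
      \<open>bubble\<close> becomes the term \<open>m = 1\<close>.\<close>
    have C: "C j 1 = {lam 1<..lam j + k}" "1 < m \<Longrightarrow> C j m = {lam m<..min (lam (m - 1)) (lam j + k)}" for m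
      by (auto simp: C_def)
    have "{1..j} = insert 1 {1<..j}"
      using j by auto
    then show "alternant (lam(j := lam j + k)) = (\<Sum>m = 1..j. (- 1) ^ (j - m) *
        (\<Sum>c\<in>C j m. bubble_coeff (lam j + k) (j - m) c * shifted_det m j c))"
      using bubble[of 1 j "lam j + k"] j assms(2) C by simp
  qed
  also have "\<dots> = (\<Sum>j = 1..n. \<Sum>m = 1..j. (- 1) ^ (j - m) *
      (\<Sum>c\<in>D j m. bubble_coeff (lam j + k) (j - m) c * shifted_det m j c))"
    by (intro sum.cong refl arg_cong2[of _ _ _ _ "(*)"] sum.mono_neutral_right)
      (use fin in \<open>auto simp: D_def bubble_coeff_def\<close>)
  also have "\<dots> = (\<Sum>j = 1..n. \<Sum>m = 1..j. \<Sum>c\<in>D j m. \<Sum>\<nu>\<in>?F j m c. ?f \<nu>)"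
  proof (intro sum.cong refl)
    fix j m assume jm: "j \<in> {1..n}" "m \<in> {1..j}"
    show "(- 1) ^ (j - m) * (\<Sum>c\<in>D j m. bubble_coeff (lam j + k) (j - m) c * shifted_det m j c)
        = (\<Sum>c\<in>D j m. \<Sum>\<nu>\<in>?F j m c. ?f \<nu>)"
      unfolding sum_distrib_left
    proof (rule sum.cong[OF refl])
      fix c assume c: "c \<in> D j m"
      then have "c \<in> C j m"
        by (simp add: D_def)
      then show "(- 1) ^ (j - m) * (bubble_coeff (lam j + k) (j - m) c * shifted_det m j c)
          = (\<Sum>\<nu>\<in>?F j m c. ?f \<nu>)"
        unfolding expand(1)[OF jm \<open>c \<in> C j m\<close>] sum_distrib_left
        by (intro sum.cong refl weight[OF jm c])
    qed
  qed
  also have "\<dots> = (\<Sum>(j, m, c, \<nu>)\<in>(SIGMA j:{1..n}. SIGMA m:{1..j}. SIGMA c:D j m. ?F j m c). ?f \<nu>)"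
  proof -
    have finF: "finite (?F j m c)" if "j \<in> {1..n}" "m \<in> {1..j}" "c \<in> D j m" for j m c
      using expand(2) that by (simp add: D_def)
    have "(\<Sum>j = 1..n. \<Sum>m = 1..j. \<Sum>c\<in>D j m. \<Sum>\<nu>\<in>?F j m c. ?f \<nu>)
        = (\<Sum>j = 1..n. \<Sum>m = 1..j. \<Sum>(c, \<nu>)\<in>(SIGMA c:D j m. ?F j m c). ?f \<nu>)"
      by (intro sum.cong refl sum.Sigma) (use fin finF in auto)
    also have "\<dots> = (\<Sum>j = 1..n. \<Sum>(m, c, \<nu>)\<in>(SIGMA m:{1..j}. SIGMA c:D j m. ?F j m c). ?f \<nu>)"
      by (intro sum.cong refl sum.Sigma) (use fin finF in \<open>auto intro!: finite_SigmaI\<close>)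
    also have "\<dots> = (\<Sum>(j, m, c, \<nu>)\<in>(SIGMA j:{1..n}. SIGMA m:{1..j}. SIGMA c:D j m. ?F j m c). ?f \<nu>)"
      by (intro sum.Sigma) (use fin finF in \<open>auto intro!: finite_SigmaI\<close>)
    finally show ?thesis .
  qed
  also have "\<dots> = sum ?f ?S"
  proof -
    have ends: "Min {m..j} = m" "Max {m..j} = j" if "m \<in> {1..j}" for m j :: nat
      using that by (auto intro: Min_eqI Max_eqI)
    show ?thesis
    \<comment> \<open>The quadruple is read off \<open>\<nu>\<close>: bottom row, top row and the
      part in the top row.\<close>
    proof (rule sum.reindex_bij_witness[where
          j = "\<lambda>(j, m, c, \<nu>). \<nu>" and
          i = "\<lambda>\<nu>. let R = fst ` skew \<nu> lam in (Max R, Min R, \<nu> (Min R), \<nu>)"], goal_cases)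
      case (1 z)
      then obtain j m c \<nu> where z: "z = (j, m, c, \<nu>)"
        and mem: "j \<in> {1..n}" "m \<in> {1..j}" "c \<in> D j m" "\<nu> \<in> ?F j m c"
        by auto
      have "fst ` skew \<nu> lam = {m..j}"
        using link[OF mem] rows_links_rows in_S[OF mem] by blast
      then show ?case
        using ends[OF mem(2)] at_m[OF mem] by (simp add: z Let_def)
    next
      case (2 z)
      then show ?case
        using in_S by auto
    next
      case (3 \<nu>)
      then show ?case
        by (simp add: Let_def)
    next
      case (4 \<nu>)
      obtain j m where mem: "j \<in> {1..n}" "m \<in> {1..j}" "\<nu> m \<in> D j m" "\<nu> \<in> ?F j m (\<nu> m)"
        using onto[OF 4] by blast
      have "fst ` skew \<nu> lam = {m..j}"
        using link[OF mem] rows_links_rows in_S[OF mem] by blast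
      then show ?case
        using mem ends[OF mem(2)] by (simp add: Let_def)
    next
      case (5 z)
      then show ?case
        by auto
    qed
  qed
  finally show ?thesis .
qed

end

text \<open>A product of two indeterminates is a monomial of positive degree, hence differs from 1;
  this keeps the denominators of the matrix entries nonzero.\<close>

lemma one_minus_indet_mult_neq_0: "1 - indet u * indet v \<noteq> (0 :: 'c::idom ratfun)"
proof
  let ?m = "\<lambda>v. Poly_Mapping.single v 1 :: nat \<Rightarrow>\<^sub>0 nat"
  assume "1 - indet u * indet v = (0 :: 'c ratfun)"
  then have "Fract (Poly_Mapping.single (?m u + ?m v) (1 :: 'c)) 1 = Fract (Poly_Mapping.single 0 1) 1"
    by (simp add: indet_def mult_single One_fract_def flip: single_one)
  then have "Poly_Mapping.single (?m u + ?m v) (1 :: 'c) = Poly_Mapping.single 0 1"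
    by (simp add: eq_fract)
  then have "Poly_Mapping.keys (Poly_Mapping.single (?m u + ?m v) (1 :: 'c))
      = Poly_Mapping.keys (Poly_Mapping.single 0 (1 :: 'c))"
    by (rule arg_cong)
  then have "?m u + ?m v = 0"
    by (simp del: single_one)
  then have "Poly_Mapping.lookup (?m u + ?m v) u = 0"
    by simp
  then show False
    by (simp add: Poly_Mapping.lookup_add Poly_Mapping.lookup_single)
qed

theorem theorem2:
  fixes n k :: nat and lam :: "nat \<Rightarrow> nat"
  assumes "n \<ge> 1" and "k \<ge> 1" and "lam \<in> partitions n"
  shows "power_sum_alpha n alpha_var k x_var * grothendieck n alpha_var beta_var x_var lam =
    (\<Sum>nu \<in> {nu \<in> partitions n. lam \<le> nu \<and> num_cols (skew nu lam) \<le> k \<and>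
                connected_shape (skew nu lam) \<and> nw_ribbon_size n nu lam \<ge> k}.
       (- alpha_var - beta_var) ^ (card (skew nu lam) - k) *
       (- 1) ^ (k - num_cols (skew nu lam)) *
       of_nat ((num_rows (skew nu lam) - 1) choose (k - num_cols (skew nu lam))) *
       (grothendieck n alpha_var beta_var x_var nu :: 'c::idom ratfun))"
proof -
  let ?\<gamma> = "alpha_var + beta_var :: 'c ratfun"
  let ?g = "\<lambda>t c i. x_var i ^ (c + n - t) * (1 + beta_var * x_var i) ^ (t - 1)
    / (1 - alpha_var * x_var i) ^ c :: 'c ratfun"
  let ?y = "\<lambda>i. x_var i / (1 - alpha_var * x_var i) :: 'c ratfun"
  let ?V = "\<Prod>(i, j)\<in>{(i, j). 1 \<le> i \<and> i < j \<and> j \<le> n}. x_var i - x_var j :: 'c ratfun"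
  have nz: "1 - alpha_var * x_var i \<noteq> (0 :: 'c ratfun)" for i
    unfolding alpha_var_def x_var_def by (rule one_minus_indet_mult_neq_0)
  \<comment> \<open>For \<open>t \<le> n\<close> the subtraction in \<open>c + n - t\<close> does
    not truncate, so raising \<open>c\<close> raises the exponent of \<open>x_var i\<close>.\<close>
  have shift: "?y i * ?g t c i = ?g t (Suc c) i" if "t \<le> n" for t c i
    using that by (simp add: Suc_diff_le field_simps)
  \<comment> \<open>The source of the recurrence: this is the factor from \<open>?g t c\<close> to
    \<open>?g (Suc t) (Suc c)\<close>, for which the exponent \<open>c + n - t\<close> stays the
    same.\<close>
  have ratio: "(1 + beta_var * x) / (1 - alpha_var * x) = 1 + ?\<gamma> * (x / (1 - alpha_var * x))"
    if "1 - alpha_var * x \<noteq> 0" for x :: "'c ratfun"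
    using that by (simp add: divide_simps) (simp add: algebra_simps)
  interpret column_family n ?g ?\<gamma> lam
  proof
    fix t c i assume t: "1 \<le> t" "t < n"
    then obtain s where s: "t = Suc s"
      by (cases t) auto
    have "?g (Suc t) (Suc c) i = ?g t c i * ((1 + beta_var * x_var i) / (1 - alpha_var * x_var i))"
      by (simp add: s mult_ac)
    also have "\<dots> = ?g t c i + ?\<gamma> * (?y i * ?g t c i)"
      unfolding ratio[OF nz] distrib_left mult_1_right by (simp only: mult_ac)
    finally show "?g (Suc t) (Suc c) i = ?g t c i + ?\<gamma> * ?g t (Suc c) i"
      unfolding shift[OF less_imp_le[OF t(2)]] .
  qed (use assms(3) in \<open>auto simp: partitions_def\<close>)
  \<comment> \<open>The Vandermonde product is common to all partitions, so the identity of
    numerators is divided by it term by term.\<close>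
  have groth: "grothendieck n alpha_var beta_var x_var nu = alternant nu / ?V" for nu
    unfolding grothendieck_def alternant_def col_det_def Let_def by (rule refl)
  have "- alpha_var - beta_var = - ?\<gamma>"
    by simp
  then show ?thesis
    unfolding groth power_sum_alpha_def power_sum_def times_divide_eq_right
    using power_sum_mult_alternant[OF assms(3,2) shift]
    by (simp only: sum_divide_distrib)
qed

end
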